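(* Let $X$ be a connected graph. Then there is a constant $k_X$ such that every connected $X$-free graph $G$ satisfies $rvc(G)\leq diam(G)+k_X$ if and only if $X=P_3$ or $X=P_4$.
   Context: All graphs are simple, finite, undirected. For a graph $G$ with a vertex-coloring $c:V(G)\to\{0,1,\dots,t\}$ (adjacent vertices may share colors), a path is vertex-rainbow if its internal vertices have pairwise distinct colors; $G$ is rainbow vertex-connected if every two distinct vertices are joined by a vertex-rainbow path. For a connected graph $G$, $rvc(G)$ is the minimum number of colors in a vertex-coloring making $G$ rainbow vertex-connected (complete graphs are assumed to have $rvc=0$). $diam(G)$ is the diameter of $G$. $P_k$ denotes the path on $k$ vertices. A graph $G$ is $X$-free if it contains no induced subgraph isomorphic to $X$.
   Formalization: X is assumed to have at least 3 vertices, since for X = P_1 and X = P_2 the claim is false (k_X = 0 works trivially); G ranges over finite graphs whose vertices are natural numbers, which covers every finite graph up to isomorphism. *)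

theory Defs
  imports "Graph_Theory.Graph_Theory"
begin

text \<open>
  Finite simple undirected graphs are the symmetric digraphs of locale \<^locale>\<open>pair_graph\<close>:
  an edge is a pair of opposite arcs.  A path is a \<^const>\<open>vpath\<close>, that is, a nonempty
  list of pairwise distinct vertices, consecutive ones being adjacent.
\<close>

definition path_between :: "('a, 'b) pre_digraph \<Rightarrow> 'a \<Rightarrow> 'a list \<Rightarrow> 'a \<Rightarrow> bool" where
  "path_between G u p v \<longleftrightarrow> vpath p G \<and> hd p = u \<and> last p = v"

definition distance :: "('a, 'b) pre_digraph \<Rightarrow> 'a \<Rightarrow> 'a \<Rightarrow> nat" where
  "distance G u v = (LEAST n. \<exists>p. path_between G u p v \<and> vwalk_length p = n)"

(* Only meaningful for finite connected graphs. *)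
definition diam :: "('a, 'b) pre_digraph \<Rightarrow> nat" where
  "diam G = Max {distance G u v | u v. u \<in> verts G \<and> v \<in> verts G}"

definition internal_verts :: "'a list \<Rightarrow> 'a list" where
  "internal_verts p = butlast (tl p)"

definition vertex_rainbow :: "('a \<Rightarrow> nat) \<Rightarrow> 'a list \<Rightarrow> bool" where
  "vertex_rainbow c p \<longleftrightarrow> distinct (map c (internal_verts p))"

definition rainbow_vertex_connected :: "('a, 'b) pre_digraph \<Rightarrow> ('a \<Rightarrow> nat) \<Rightarrow> bool" where
  "rainbow_vertex_connected G c \<longleftrightarrow>
     (\<forall>u \<in> verts G. \<forall>v \<in> verts G. u \<noteq> v \<longrightarrow> (\<exists>p. path_between G u p v \<and> vertex_rainbow c p))"

text \<open>
  Colors are natural numbers, and a coloring uses as many colors as it takes values on the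
  vertices.  Since every coloring of a nonempty graph uses some color, the value 0 for complete
  graphs (including the one-vertex graph) is a separate convention.
\<close>

definition rvc :: "('a, 'b) pre_digraph \<Rightarrow> nat" where
  "rvc G = (if complete_digraph (card (verts G)) G then 0
            else LEAST k. \<exists>c. rainbow_vertex_connected G c \<and> card (c ` verts G) = k)"

definition free_of :: "('a, 'b) pre_digraph \<Rightarrow> ('c, 'd) pre_digraph \<Rightarrow> bool" where
  "free_of X G \<longleftrightarrow> \<not> (\<exists>H. induced_subgraph H G \<and> digraph_iso H X)"

(* The path on n vertices 0, ..., n - 1. *)
definition path_graph :: "nat \<Rightarrow> nat pair_pre_digraph" where
  "path_graph n = \<lparr>pverts = {..<n},
     parcs = {(i, j). i < n \<and> j < n \<and> (j = Suc i \<or> i = Suc j)}\<rparr>"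

end

theory Submission
  imports Defs
begin

text \<open>
  A connected \<open>P\<^sub>4\<close>-free graph has diameter at most 2, so a single color makes it rainbow
  vertex-connected; this settles \<open>P\<^sub>3\<close> and \<open>P\<^sub>4\<close>.

  Conversely, attach a pendant vertex to every vertex of a graph \<open>B\<close> on \<open>n\<close> vertices.  The ends of
  every path between the pendants of \<open>i\<close> and \<open>j\<close> are forced to run through \<open>i\<close> and \<open>j\<close>, so all
  \<open>n\<close> vertices of \<open>B\<close> need different colors, whereas the diameter is at most 4 as soon as \<open>B\<close>
  has a dominating vertex.  Hence \<open>X\<close> is an induced subgraph of such a corona both for
  \<open>B = K\<^bsub>n\<^esub>\<close> and for \<open>B = K\<^bsub>1,n-1\<^esub>\<close>.  The corona of a star has no triangle, so \<open>X\<close> meets the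
  clique of the other corona in at most two vertices; being connected, it has no other
  vertices than these two and their pendants.
\<close>

section \<open>Induced embeddings\<close>

text \<open>Vertex maps stand in for the subgraphs and isomorphism records behind
  \<open>free_of\<close>: they compose and can be written down explicitly.\<close>

definition induced_embedding ::
    "('a \<Rightarrow> 'b) \<Rightarrow> 'a pair_pre_digraph \<Rightarrow> 'b pair_pre_digraph \<Rightarrow> bool" where
  "induced_embedding f X G \<longleftrightarrow> inj_on f (pverts X) \<and> f ` pverts X \<subseteq> pverts G \<and>
     (\<forall>u \<in> pverts X. \<forall>v \<in> pverts X. (f u, f v) \<in> parcs G \<longleftrightarrow> (u, v) \<in> parcs X)"

lemma induced_embedding_comp:
  assumes "induced_embedding f X Y" and "induced_embedding g Y Z"
  shows "induced_embedding (g \<circ> f) X Z"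
proof -
  have "inj_on (g \<circ> f) (pverts X)"
    using assms unfolding induced_embedding_def by (meson comp_inj_on inj_on_subset)
  with assms show ?thesis unfolding induced_embedding_def by (auto simp: image_subset_iff)
qed

lemma digraph_iso_imp_induced_embedding:
  assumes "digraph_iso (with_proj X) (with_proj Y)" and "pair_wf_digraph X"
  shows "\<exists>f. induced_embedding f X Y \<and> f ` pverts X = pverts Y"
proof -
  interpret X: pair_wf_digraph X by fact
  obtain h where h: "pre_digraph.digraph_isomorphism (with_proj X) h"
    and Y: "with_proj Y = app_iso h (with_proj X)"
    using assms(1) unfolding digraph_iso_def by auto
  let ?f = "iso_verts h"
  have inj: "inj_on ?f (pverts X)"
    using X.digraph_isomorphism_inj_on_verts[OF h] by simp
  have V: "pverts Y = ?f ` pverts X"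
    using arg_cong[OF Y, of verts] by simp
  have E: "parcs Y = (\<lambda>(u,v). (?f u, ?f v)) ` parcs X"
    using X.arcs_ends_app_iso_eq[OF h] arg_cong[OF Y, of arcs_ends] by simp
  have "(?f u, ?f v) \<in> parcs Y \<longleftrightarrow> (u, v) \<in> parcs X"
    if uv: "u \<in> pverts X" "v \<in> pverts X" for u v
  proof
    assume "(?f u, ?f v) \<in> parcs Y"
    then obtain a b where ab: "(a, b) \<in> parcs X" "?f u = ?f a" "?f v = ?f b"
      unfolding E by auto
    then have "u = a" "v = b"
      using inj_onD[OF inj] uv X.wellformed'[OF ab(1)] by blast+
    with ab show "(u, v) \<in> parcs X" by simp
  qed (auto simp: E)
  with inj V show ?thesis unfolding induced_embedding_def by blast
qed

text \<open>Arcs are pairs, so the vertex map forces the rest of the isomorphism record: arcs are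
  mapped componentwise, and head and tail stay the projections.\<close>

lemma induced_embedding_imp_digraph_iso:
  assumes f: "induced_embedding f X Y" and V: "f ` pverts X = pverts Y"
    and "pair_wf_digraph X" and "pair_wf_digraph Y"
  shows "digraph_iso (with_proj X) (with_proj Y)"
proof -
  interpret X: pair_wf_digraph X by fact
  interpret Y: pair_wf_digraph Y by fact
  let ?h = "\<lparr>iso_verts = f, iso_arcs = map_prod f f, iso_head = snd, iso_tail = fst\<rparr>"
  have inj: "inj_on f (pverts X)" using f by (simp add: induced_embedding_def)
  have "inj_on (map_prod f f) (parcs X)"
    by (rule inj_on_subset[OF map_prod_inj_on[OF inj inj]]) (auto dest: X.wellformed')
  then have 1: "pre_digraph.digraph_isomorphism (with_proj X) ?h"
    using inj X.wf_digraph_axioms by (auto simp: pre_digraph.digraph_isomorphism_def)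
  have "parcs Y = map_prod f f ` parcs X"
  proof (intro set_eqI iffI)
    fix e assume e: "e \<in> parcs Y"
    then obtain a b where ab: "e = (f a, f b)" "a \<in> pverts X" "b \<in> pverts X"
      using Y.wellformed' V by (metis imageE prod.collapse)
    then have "(a, b) \<in> parcs X" using f e by (auto simp: induced_embedding_def)
    then show "e \<in> map_prod f f ` parcs X" using ab by force
  next
    fix e assume "e \<in> map_prod f f ` parcs X"
    then obtain a b where "e = (f a, f b)" "(a, b) \<in> parcs X" by auto
    then show "e \<in> parcs Y" using f X.wellformed' by (auto simp: induced_embedding_def)
  qed
  then have "with_proj Y = app_iso ?h (with_proj X)"
    using V by (simp add: app_iso_def with_proj_def)
  with 1 show ?thesis unfolding digraph_iso_def by blast
qed

lemma free_of_with_proj_iff: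
  assumes "pair_wf_digraph X" and "pair_wf_digraph G"
  shows "free_of (with_proj X) (with_proj G) \<longleftrightarrow> \<not> (\<exists>f. induced_embedding f X G)"
proof -
  interpret X: pair_wf_digraph X by fact
  interpret G: pair_wf_digraph G by fact
  have "\<exists>f. induced_embedding f X G"
    if H: "induced_subgraph H (with_proj G)" and iso: "digraph_iso H (with_proj X)" for H
  proof -
    \<comment> \<open>\<open>H\<close> is a general digraph record, but as a subgraph of
      \<open>with_proj G\<close> it inherits the projections as tail and head, hence comes from a
      pair digraph.\<close>
    define H' where "H' = \<lparr>pverts = verts H, parcs = arcs H\<rparr>"
    have H': "H = with_proj H'"
      using H by (auto simp: H'_def with_proj_def induced_subgraph_def subgraph_def compatible_def)
    have "wf_digraph H" using H by (auto simp: induced_subgraph_def subgraph_def)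
    then have "digraph_iso (with_proj X) (with_proj H')"
      using iso digraph_iso_swap H' by blast
    then obtain f where f: "induced_embedding f X H'"
      using digraph_iso_imp_induced_embedding X.pair_wf_digraph_axioms by blast
    have "induced_embedding id H' G"
      using H unfolding H' by (auto simp: induced_embedding_def induced_subgraph_def subgraph_def)
    with f show ?thesis using induced_embedding_comp by blast
  qed
  moreover have "\<exists>H. induced_subgraph H (with_proj G) \<and> digraph_iso H (with_proj X)"
    if f: "induced_embedding f X G" for f
  proof -
    define H where "H = \<lparr>pverts = f ` pverts X,
      parcs = {e \<in> parcs G. fst e \<in> f ` pverts X \<and> snd e \<in> f ` pverts X}\<rparr>"
    have wf: "pair_wf_digraph H" by unfold_locales (auto simp: H_def)
    have "induced_subgraph (with_proj H) (with_proj G)"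
      using f wf G.wf_digraph_axioms
      by (auto simp: induced_subgraph_def subgraph_def compatible_def H_def induced_embedding_def
          wf_digraph_wp_iff)
    moreover have "induced_embedding f X H"
      using f by (auto simp: induced_embedding_def H_def)
    then have "digraph_iso (with_proj X) (with_proj H)"
      using wf X.pair_wf_digraph_axioms
      by (intro induced_embedding_imp_digraph_iso) (auto simp: H_def)
    then have "digraph_iso (with_proj H) (with_proj X)"
      using digraph_iso_swap X.wf_digraph_axioms by blast
    ultimately show ?thesis by blast
  qed
  ultimately show ?thesis unfolding free_of_def by blast
qed

section \<open>Simple graphs, and path graphs given by vertex lists\<close>

lemma pair_graphI:
  assumes "finite (pverts G)" and "parcs G \<subseteq> pverts G \<times> pverts G"
    and "irrefl (parcs G)" and "sym (parcs G)"
  shows "pair_graph G"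
proof -
  have "finite (parcs G)" using assms finite_subset by blast
  with assms show ?thesis
    by unfold_locales (auto simp: symmetric_def irrefl_def)
qed

lemma pair_graph_path_graph: "pair_graph (path_graph n)"
  by (rule pair_graphI) (auto simp: path_graph_def irrefl_def sym_def)

text \<open>Symmetry and the absence of loops reduce everything to index pairs \<open>i < j\<close>;
  for a concrete list these are finitely many adjacencies for the simplifier.\<close>

lemma induced_embedding_path_graphI:
  assumes "pair_graph G" and "distinct xs" and "set xs \<subseteq> pverts G"
    and adj: "\<forall>j<length xs. \<forall>i<j. (xs ! i, xs ! j) \<in> parcs G \<longleftrightarrow> j = Suc i"
  shows "induced_embedding ((!) xs) (path_graph (length xs)) G"
  unfolding induced_embedding_def
proof (intro conjI ballI)
  interpret G: pair_graph G by fact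
  show "inj_on ((!) xs) (pverts (path_graph (length xs)))"
    using assms(2) by (auto simp: path_graph_def inj_on_def nth_eq_iff_index_eq)
  show "(!) xs ` pverts (path_graph (length xs)) \<subseteq> pverts G"
    using assms(3) nth_mem by (fastforce simp: path_graph_def)
  fix i j assume "i \<in> pverts (path_graph (length xs))" "j \<in> pverts (path_graph (length xs))"
  then have ij: "i < length xs" "j < length xs" by (auto simp: path_graph_def)
  have "(xs ! i, xs ! j) \<in> parcs G \<longleftrightarrow> j = Suc i \<or> i = Suc j"
  proof (cases i j rule: linorder_cases)
    case less
    then show ?thesis using adj ij by auto
  next
    case equal
    then show ?thesis using G.no_loops' by auto
  next
    case greater
    have "(xs ! i, xs ! j) \<in> parcs G \<longleftrightarrow> (xs ! j, xs ! i) \<in> parcs G"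
      using G.arcs_symmetric by blast
    then show ?thesis using greater adj ij by auto
  qed
  then show "(xs ! i, xs ! j) \<in> parcs G \<longleftrightarrow> (i, j) \<in> parcs (path_graph (length xs))"
    using ij by (simp add: path_graph_def)
qed

lemma digraph_iso_path_graphI:
  assumes "pair_graph X" and "distinct xs" and xs: "set xs = pverts X"
    and "\<forall>j<length xs. \<forall>i<j. (xs ! i, xs ! j) \<in> parcs X \<longleftrightarrow> j = Suc i"
  shows "digraph_iso (with_proj X) (with_proj (path_graph (length xs)))"
proof -
  interpret X: pair_graph X by fact
  interpret P: pair_graph "path_graph (length xs)" by (rule pair_graph_path_graph)
  have "induced_embedding ((!) xs) (path_graph (length xs)) X"
    by (rule induced_embedding_path_graphI) (use assms in auto)
  moreover have "(!) xs ` pverts (path_graph (length xs)) = pverts X"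
    unfolding xs[symmetric] by (auto simp: path_graph_def in_set_conv_nth)
  ultimately have "digraph_iso (with_proj (path_graph (length xs))) (with_proj X)"
    by (rule induced_embedding_imp_digraph_iso[OF _ _ P.pair_wf_digraph_axioms X.pair_wf_digraph_axioms])
  then show ?thesis by (rule digraph_iso_swap[OF P.wf_digraph_axioms])
qed

section \<open>Connected graphs without induced paths on four vertices\<close>

text \<open>Connectedness as an induction principle, by induction along a walk from
  \<open>u\<close>. It is applied below to a ball and to a singleton.\<close>

lemma connected_closed_subset:
  assumes "pair_graph G" and "connected (with_proj G)" and "u \<in> S" and "u \<in> pverts G"
    and "v \<in> pverts G" and closed: "\<And>x y. x \<in> S \<Longrightarrow> (x, y) \<in> parcs G \<Longrightarrow> y \<in> S"
  shows "v \<in> S"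
proof -
  interpret G: pair_graph G by fact
  have "(parcs G)\<^sup>s = parcs G"
    using G.arcs_symmetric by (auto simp: symcl_def)
  then have "(u, v) \<in> rtrancl_on (pverts G) (parcs G)"
    using assms(2,4,5) by (simp add: connected_conv)
  then show ?thesis
  proof (induct rule: rtrancl_on_induct)
    case base
    show ?case by fact
  next
    case (step x y)
    then show ?case using closed by blast
  qed
qed

text \<open>A vertex adjacent to the ball of radius 2 around \<open>u\<close> but outside it has
  distance 3 from \<open>u\<close>, and a shortest path to it is an induced path on four vertices.
  So the ball \<open>S\<close> is closed under adjacency and contains \<open>v\<close>.\<close>

lemma P4_free_common_neighbour:
  assumes "pair_graph G" and "connected (with_proj G)"
    and free: "\<nexists>f. induced_embedding f (path_graph 4) G"
    and "u \<in> pverts G" and "v \<in> pverts G" and "u \<noteq> v" and "(u, v) \<notin> parcs G"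
  shows "\<exists>w. (u, w) \<in> parcs G \<and> (w, v) \<in> parcs G"
proof -
  interpret G: pair_graph G by fact
  define S where "S = {v. v = u \<or> (u, v) \<in> parcs G \<or> (\<exists>w. (u, w) \<in> parcs G \<and> (w, v) \<in> parcs G)}"
  have "y \<in> S" if x: "x \<in> S" and xy: "(x, y) \<in> parcs G" for x y
  proof (rule ccontr)
    assume y: "y \<notin> S"
    obtain w where w: "(u, w) \<in> parcs G" "(w, x) \<in> parcs G"
      using x xy y unfolding S_def by blast
    have non: "(u, x) \<notin> parcs G" "(u, y) \<notin> parcs G" "(w, y) \<notin> parcs G" "u \<noteq> y" "u \<noteq> x" "w \<noteq> y"
      using y w xy unfolding S_def by blast+
    have "u \<noteq> w" "w \<noteq> x" "x \<noteq> y" using w xy G.no_loops' by blast+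
    moreover have "u \<in> pverts G" "w \<in> pverts G" "x \<in> pverts G" "y \<in> pverts G"
      using w xy G.wellformed' by blast+
    ultimately have "induced_embedding ((!) [u, w, x, y]) (path_graph (length [u, w, x, y])) G"
      using w xy non
      by (intro induced_embedding_path_graphI[OF assms(1)]) (simp_all add: All_less_Suc)
    then have "induced_embedding ((!) [u, w, x, y]) (path_graph 4) G"
      by (simp add: numeral_eq_Suc)
    with free show False by blast
  qed
  then have "v \<in> S"
    using connected_closed_subset[OF assms(1,2) _ assms(4,5), of S] by (auto simp: S_def)
  with assms(6,7) show ?thesis by (auto simp: S_def)
qed

text \<open>Any two vertices are joined by a path with at most one internal vertex, which is rainbow
  even for a constant coloring.\<close>

lemma P4_free_rvc_le_1:
  assumes "pair_graph G" and "connected (with_proj G)"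
    and free: "\<nexists>f. induced_embedding f (path_graph 4) G"
  shows "rvc (with_proj G) \<le> 1"
proof -
  interpret G: pair_graph G by fact
  let ?c = "\<lambda>_. 0 :: nat"
  have "\<exists>p. path_between (with_proj G) u p v \<and> vertex_rainbow ?c p"
    if uv: "u \<in> pverts G" "v \<in> pverts G" "u \<noteq> v" for u v
  proof (cases "(u, v) \<in> parcs G")
    case True
    then have "path_between (with_proj G) u [u, v] v \<and> vertex_rainbow ?c [u, v]"
      using uv by (auto simp: path_between_def vpath_def vertex_rainbow_def internal_verts_def)
    then show ?thesis by blast
  next
    case False
    then obtain w where w: "(u, w) \<in> parcs G" "(w, v) \<in> parcs G"
      using P4_free_common_neighbour[OF assms uv] by blast
    then have "path_between (with_proj G) u [u, w, v] v \<and> vertex_rainbow ?c [u, w, v]"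
      using uv G.no_loops' by (auto simp: path_between_def vpath_def vertex_rainbow_def internal_verts_def)
    then show ?thesis by blast
  qed
  then have "rainbow_vertex_connected (with_proj G) ?c"
    by (simp add: rainbow_vertex_connected_def)
  then have "(LEAST k. \<exists>c. rainbow_vertex_connected (with_proj G) c \<and> card (c ` pverts G) = k)
      \<le> card (?c ` pverts G)"
    by (intro Least_le) blast
  also have "card (?c ` pverts G) \<le> card {0::nat}"
    by (rule card_mono) auto
  finally show ?thesis by (simp add: rvc_def)
qed

text \<open>A path on at most four vertices is an initial segment of \<open>path_graph 4\<close>, so
  an induced \<open>path_graph 4\<close> in \<open>G\<close> would yield an induced copy of
  \<open>X\<close>.\<close>

lemma rvc_le_1_of_path_free:
  assumes "pair_graph X" and "digraph_iso (with_proj X) (with_proj (path_graph n))" and "n \<le> 4"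
    and "pair_graph G" and "connected (with_proj G)" and "free_of (with_proj X) (with_proj G)"
  shows "rvc (with_proj G) \<le> 1"
proof (rule P4_free_rvc_le_1[OF assms(4,5)])
  interpret X: pair_graph X by fact
  interpret G: pair_graph G by fact
  obtain g where g: "induced_embedding g X (path_graph n)"
    using digraph_iso_imp_induced_embedding[OF assms(2) X.pair_wf_digraph_axioms] by blast
  have "induced_embedding id (path_graph n) (path_graph 4)"
    using assms(3) by (auto simp: induced_embedding_def path_graph_def)
  then have "induced_embedding (f \<circ> (id \<circ> g)) X G" if "induced_embedding f (path_graph 4) G" for f
    by (rule induced_embedding_comp[OF induced_embedding_comp[OF g] that])
  with assms(6) show "\<nexists>f. induced_embedding f (path_graph 4) G"
    using free_of_with_proj_iff[OF X.pair_wf_digraph_axioms G.pair_wf_digraph_axioms] by blast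
qed

section \<open>Coronas\<close>

text \<open>Distances are defined by paths, but walks are easier to concatenate. Shortcutting a walk
  to a path keeps its ends and adds no vertices.\<close>

lemma distance_le_vwalk:
  assumes "vwalk p G"
  shows "distance G (hd p) (last p) \<le> length p - 1"
proof -
  let ?q = "vwalk_to_vpath p"
  have q: "vpath ?q G" using assms by (rule vwalk_to_vpath_vpath)
  have "distance G (hd p) (last p) \<le> vwalk_length ?q"
    unfolding distance_def
    by (rule Least_le) (use q vwalk_to_vpath_hd vwalk_to_vpath_last in \<open>auto simp: path_between_def\<close>)
  moreover have "length ?q \<le> length p"
  proof -
    have "length ?q = card (set ?q)" using q by (simp add: vpath_def distinct_card)
    also have "\<dots> \<le> card (set p)"
      by (rule card_mono) (auto dest: vwalk_to_vpath_subset)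
    also have "\<dots> \<le> length p" by (rule card_length)
    finally show ?thesis .
  qed
  ultimately show ?thesis by simp
qed

text \<open>Any two vertices are joined by a walk through the hub \<open>r\<close>. Lengths of lists
  count vertices, so \<open>Suc d\<close> stands for \<open>d\<close> arcs.\<close>

lemma radius_bound:
  assumes "pair_graph G" and r: "r \<in> pverts G"
    and hub: "\<And>u. u \<in> pverts G \<Longrightarrow>
      \<exists>p. vwalk p (with_proj G) \<and> hd p = u \<and> last p = r \<and> length p \<le> Suc d"
  shows "connected (with_proj G)" and "diam (with_proj G) \<le> 2 * d"
proof -
  interpret G: pair_graph G by fact
  have walk: "\<exists>p. vwalk p (with_proj G) \<and> hd p = u \<and> last p = v \<and> length p \<le> Suc (2 * d)"
    if uv: "u \<in> pverts G" "v \<in> pverts G" for u v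
  proof -
    obtain p q where p: "vwalk p (with_proj G)" "hd p = u" "last p = r" "length p \<le> Suc d"
      and q: "vwalk q (with_proj G)" "hd q = v" "last q = r" "length q \<le> Suc d"
      using hub uv by blast
    have ne: "p \<noteq> []" "q \<noteq> []" using p q by auto
    have rq: "vwalk (rev q) (with_proj G)"
      using vwalk_rev_ex G.sym_arcs q(1) by blast
    have j: "joinable p (rev q)" using p q ne by (auto simp: hd_rev)
    have "vwalk (p \<oplus> rev q) (with_proj G)" by (rule vwalk_joinI_vwalk[OF p(1) rq j])
    moreover have "hd (p \<oplus> rev q) = u" "last (p \<oplus> rev q) = v"
      using vwalk_join_hd[OF j] vwalk_join_last[OF j] p q ne by (auto simp: last_rev)
    \<comment> \<open>The join keeps the shared vertex \<open>r\<close> only once, whence the bound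
      \<open>2 * d + 1\<close> on the number of vertices.\<close>
    moreover have "length (p \<oplus> rev q) \<le> Suc (2 * d)"
      using vwalk_join_vwalk_length[OF j] p(4) q(4) ne by (simp add: vwalk_join_def)
    ultimately show ?thesis by blast
  qed
  have "strongly_connected (with_proj G)"
    using r walk by (auto simp: strongly_connected_def G.reachable_vwalk_conv)
  then show "connected (with_proj G)"
    using r G.reachable_mk_symmetricI by (auto intro!: G.connectedI simp: strongly_connected_def)
  have "distance (with_proj G) u v \<le> 2 * d" if "u \<in> pverts G" "v \<in> pverts G" for u v
    using walk[OF that] distance_le_vwalk by fastforce
  moreover have "{distance (with_proj G) u v | u v. u \<in> pverts G \<and> v \<in> pverts G}
      = (\<lambda>(u, v). distance (with_proj G) u v) ` (pverts G \<times> pverts G)" by auto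
  ultimately show "diam (with_proj G) \<le> 2 * d"
    using r G.finite_verts unfolding diam_def by (subst Max_le_iff) auto
qed

(* The base vertices are 0, ..., n - 1, and the pendant vertex at i is i + n. *)
definition corona :: "nat \<Rightarrow> (nat \<Rightarrow> nat \<Rightarrow> bool) \<Rightarrow> nat pair_pre_digraph" where
  "corona n E = \<lparr>pverts = {..<2 * n},
     parcs = {(i, j). i < n \<and> j < n \<and> E i j \<or> i < n \<and> j = i + n \<or> j < n \<and> i = j + n}\<rparr>"

text \<open>Vertex 0 dominates the base graph, which bounds the diameter independently of
  \<open>n\<close>; cliques and stars are the two instances. With \<open>n \<ge> 2\<close> the
  corona is not complete, so \<open>rvc\<close> is not the conventional 0.\<close>

locale dominated_corona =
  fixes n :: nat and E :: "nat \<Rightarrow> nat \<Rightarrow> bool"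
  assumes E_sym: "E i j \<Longrightarrow> E j i" and E_irrefl: "\<not> E i i"
    and E_dom: "j \<noteq> 0 \<Longrightarrow> E j 0" and n: "n \<ge> 2"
begin

abbreviation G where "G \<equiv> corona n E"

sublocale pair_graph G
  by (rule pair_graphI)
    (use E_sym E_irrefl in \<open>auto simp: corona_def irrefl_def sym_def\<close>)

lemma walk_to_root:
  assumes "u \<in> pverts G"
  shows "\<exists>p. vwalk p (with_proj G) \<and> hd p = u \<and> last p = 0 \<and> length p \<le> Suc 2"
proof -
  have base: "\<exists>p. vwalk p (with_proj G) \<and> hd p = i \<and> last p = 0 \<and> length p \<le> 2" if "i < n" for i
  proof -
    have "i \<noteq> 0 \<Longrightarrow> (i, 0) \<in> parcs G" and "i \<in> pverts G" and "0 \<in> pverts G"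
      using that E_dom[of i] by (auto simp: corona_def)
    then show ?thesis by (intro exI[of _ "if i = 0 then [0] else [i, 0]"]) auto
  qed
  show ?thesis
  proof (cases "u < n")
    case True
    then show ?thesis using base[of u] by (auto intro: le_SucI)
  next
    case False
    then have u: "u - n < n" "u = u - n + n" using assms by (auto simp: corona_def)
    obtain p where p: "vwalk p (with_proj G)" "hd p = u - n" "last p = 0" "length p \<le> 2"
      using base[OF u(1)] by blast
    have "vwalk (u # p) (with_proj G)"
      using p u by (intro vwalk_consI) (auto simp: corona_def)
    then show ?thesis using p by (intro exI[of _ "u # p"]) auto
  qed
qed

lemma G_connected: "connected (with_proj G)" and diam_G: "diam (with_proj G) \<le> 4"
proof -
  have "0 \<in> pverts G" using n by (simp add: corona_def)
  from radius_bound[OF pair_graph this walk_to_root]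
  show "connected (with_proj G)" "diam (with_proj G) \<le> 4" by simp_all
qed

lemma pendant_neighbour: "i < n \<Longrightarrow> (i + n, x) \<in> parcs G \<longleftrightarrow> x = i"
  by (auto simp: corona_def)

text \<open>A path between the pendants at \<open>i\<close> and \<open>j\<close> must leave through
  \<open>i\<close> and arrive through \<open>j\<close>. Both are then internal vertices, so a
  rainbow path gives them different colors.\<close>

lemma rainbow_inj_on_base:
  assumes "rainbow_vertex_connected (with_proj G) c"
  shows "inj_on c {..<n}"
proof (rule inj_onI, rule ccontr)
  fix i j assume ij: "i \<in> {..<n}" "j \<in> {..<n}" "c i = c j" "i \<noteq> j"
  obtain p where p: "vpath p (with_proj G)" "hd p = i + n" "last p = j + n"
    and rainbow: "distinct (map c (internal_verts p))"
  proof -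
    have "i + n \<in> pverts G" "j + n \<in> pverts G" "i + n \<noteq> j + n" using ij by (auto simp: corona_def)
    with assms that show ?thesis
      unfolding rainbow_vertex_connected_def path_between_def vertex_rainbow_def with_proj_simps
      by blast
  qed
  obtain q where q: "p = (i + n) # q" using p by (cases p) auto
  have "q \<noteq> []" using p ij q by auto
  then have hq: "hd q = i" using p q ij pendant_neighbour by (auto simp: vpath_def vwalk_def)
  obtain s where s: "q = s @ [j + n]" using \<open>q \<noteq> []\<close> p q by (metis append_butlast_last_id last_ConsR)
  \<comment> \<open>Otherwise \<open>hd q = j + n\<close> would be the base vertex \<open>i\<close>.
    So \<open>s\<close> consists of the internal vertices of \<open>p\<close> and starts with
    \<open>i\<close>.\<close>
  have "s \<noteq> []" using s hq ij by auto
  then have "(last s, j + n) \<in> parcs G"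
    using p q s vwalk_arcs_append[of "(i + n) # s" "[j + n]"] by (auto simp: vpath_def vwalk_def)
  then have "last s = j" using ij pendant_neighbour arcs_symmetric by blast
  then have "i \<in> set s" "j \<in> set s" using \<open>s \<noteq> []\<close> hq s by auto
  moreover have "inj_on c (set s)"
    using rainbow q s by (simp add: internal_verts_def distinct_map)
  ultimately show False using ij by (auto dest: inj_onD)
qed

lemma rvc_G: "n \<le> rvc (with_proj G)"
proof -
  let ?k = "LEAST k. \<exists>c. rainbow_vertex_connected (with_proj G) c \<and> card (c ` pverts G) = k"
  have "(0, n + 1) \<notin> parcs G" "0 \<in> pverts G" "n + 1 \<in> pverts G"
    using n by (auto simp: corona_def)
  then have not_complete: "\<not> complete_digraph (card (pverts G)) (with_proj G)"
    by (auto simp: complete_digraph_def)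
  \<comment> \<open>For \<open>LEAST\<close> to be attained some coloring must work: with
    \<open>id\<close> all colors differ, so every path is rainbow.\<close>
  have "strongly_connected (with_proj G)"
    using symmetric_connected_imp_strongly_connected sym_arcs G_connected by blast
  then have "rainbow_vertex_connected (with_proj G) id"
    by (auto simp: rainbow_vertex_connected_def path_between_def strongly_connected_def
        reachable_vpath_conv vertex_rainbow_def internal_verts_def distinct_tl distinct_butlast)
       (meson distinct_butlast distinct_tl vpathE)
  then have "\<exists>k c. rainbow_vertex_connected (with_proj G) c \<and> card (c ` pverts G) = k"
    by blast
  then have "\<exists>c. rainbow_vertex_connected (with_proj G) c \<and> card (c ` pverts G) = ?k"
    by (rule LeastI_ex)
  then obtain c where c: "rainbow_vertex_connected (with_proj G) c" "card (c ` pverts G) = ?k"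
    by blast
  have "n = card (c ` {..<n})" using rainbow_inj_on_base[OF c(1)] by (simp add: card_image)
  also have "\<dots> \<le> card (c ` pverts G)" by (rule card_mono) (auto simp: corona_def)
  finally show ?thesis using c not_complete by (simp add: rvc_def)
qed

text \<open>An \<open>X\<close>-free corona would satisfy
  \<open>n \<le> rvc \<le> diam + k \<le> 4 + k\<close>.\<close>

lemma induced_embedding_of_bound:
  assumes "\<And>H :: nat pair_pre_digraph. \<lbrakk>pair_graph H; connected (with_proj H);
      free_of (with_proj X) (with_proj H)\<rbrakk> \<Longrightarrow> rvc (with_proj H) \<le> diam (with_proj H) + k"
    and "pair_graph X" and "n > k + 4"
  shows "\<exists>f. induced_embedding f X G"
proof -
  interpret X: pair_graph X by fact
  have "\<not> free_of (with_proj X) (with_proj G)"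
  proof
    assume "free_of (with_proj X) (with_proj G)"
    then have "rvc (with_proj G) \<le> diam (with_proj G) + k"
      by (rule assms(1)[OF pair_graph G_connected])
    with assms(3) rvc_G diam_G show False by linarith
  qed
  then show ?thesis
    using free_of_with_proj_iff[OF X.pair_wf_digraph_axioms pair_wf_digraph_axioms] by blast
qed

end

section \<open>Graphs embedded in the coronas of a star and of a clique\<close>

text \<open>The relation makes 0 the center of a star. Its corona is a tree, and triangles of
  \<open>X\<close> would be carried into it.\<close>

lemma star_corona_triangle_free:
  assumes "n \<ge> 2" and "induced_embedding f X (corona n (\<lambda>i j. (i = 0) \<noteq> (j = 0)))"
      (is "induced_embedding _ _ ?C")
    and "a \<in> pverts X" "b \<in> pverts X" "c \<in> pverts X"
  shows "\<not> ((a, b) \<in> parcs X \<and> (b, c) \<in> parcs X \<and> (a, c) \<in> parcs X)"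
proof
  assume "(a, b) \<in> parcs X \<and> (b, c) \<in> parcs X \<and> (a, c) \<in> parcs X"
  then have "(f a, f b) \<in> parcs ?C" "(f b, f c) \<in> parcs ?C" "(f a, f c) \<in> parcs ?C"
    using assms by (simp_all add: induced_embedding_def)
  then show False unfolding corona_def by simp linarith
qed

lemma connected_ex_neighbour:
  assumes "pair_graph X" and "connected (with_proj X)" and "card (pverts X) \<ge> 2"
    and "x \<in> pverts X"
  shows "\<exists>y. (x, y) \<in> parcs X"
proof (rule ccontr)
  assume "\<nexists>y. (x, y) \<in> parcs X"
  then have "v \<in> {x}" if "v \<in> pverts X" for v
    by (intro connected_closed_subset[OF assms(1,2) _ assms(4) that]) auto
  then have "pverts X \<subseteq> {x}" by blast
  then have "card (pverts X) \<le> card {x}" by (intro card_mono) auto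
  with assms(3) show False by simp
qed

text \<open>Exactly two vertices of \<open>X\<close> land in the clique and every other one is a
  pendant at one of them. One pendant gives the path on three vertices, one at each end the path on
  four.\<close>

lemma path_of_clique_corona_embedding:
  assumes "pair_graph X" and "connected (with_proj X)" and card: "card (pverts X) \<ge> 3"
    and f: "induced_embedding f X (corona n (\<noteq>))"
    and triangle_free: "\<And>a b c. \<lbrakk>a \<in> pverts X; b \<in> pverts X; c \<in> pverts X\<rbrakk> \<Longrightarrow>
      \<not> ((a, b) \<in> parcs X \<and> (b, c) \<in> parcs X \<and> (a, c) \<in> parcs X)"
  shows "digraph_iso (with_proj X) (with_proj (path_graph 3))
       \<or> digraph_iso (with_proj X) (with_proj (path_graph 4))"
proof -
  interpret X: pair_graph X by fact
  define A where "A = {x \<in> pverts X. f x < n}"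
  have f_eq: "f x = f y \<longleftrightarrow> x = y" if "x \<in> pverts X" "y \<in> pverts X" for x y
    using that f by (auto simp: induced_embedding_def inj_on_eq_iff)
  have adj: "(x, y) \<in> parcs X \<longleftrightarrow> x \<in> A \<and> y \<in> A \<and> x \<noteq> y
      \<or> x \<in> A \<and> f y = f x + n \<or> y \<in> A \<and> f x = f y + n"
    if "x \<in> pverts X" "y \<in> pverts X" for x y
  proof -
    have "(x, y) \<in> parcs X \<longleftrightarrow> (f x, f y) \<in> parcs (corona n (\<noteq>))"
      using that f by (simp add: induced_embedding_def)
    then show ?thesis using that f_eq by (auto simp: corona_def A_def)
  qed
  \<comment> \<open>A pendant has only one possible neighbor, and connectedness forces it to be
    present in \<open>X\<close>.\<close>
  have support: "\<exists>y\<in>A. f x = f y + n" if x: "x \<in> pverts X" "x \<notin> A" for x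
  proof -
    obtain y where "(x, y) \<in> parcs X"
      using connected_ex_neighbour[OF assms(1,2) _ x(1)] card by auto
    then show ?thesis using adj[of x y] x X.wellformed' by auto
  qed
  have A_sub: "A \<subseteq> pverts X" and finA: "finite A" by (auto simp: A_def X.finite_verts)
  \<comment> \<open>Distinct pendants have distinct supports, so at least half of the three or more
    vertices lie in \<open>A\<close>.\<close>
  have "card A \<ge> 2"
  proof -
    have "f ` (pverts X - A) \<subseteq> (\<lambda>y. f y + n) ` A" using support by auto
    then have "card (f ` (pverts X - A)) \<le> card A"
      using card_mono card_image_le finA by (meson finite_imageI le_trans)
    moreover have "inj_on f (pverts X - A)"
      using f by (auto simp: induced_embedding_def intro: inj_on_subset)
    ultimately have "card (pverts X - A) \<le> card A" by (simp add: card_image)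
    then show ?thesis using card card_Diff_subset[OF finA A_sub] by simp
  qed
  then obtain T where "T \<subseteq> A" "card T = 2" by (rule obtain_subset_with_card_n)
  then obtain a b where ab: "a \<in> A" "b \<in> A" "a \<noteq> b" by (auto simp: card_2_iff)
  \<comment> \<open>A third vertex in the clique would complete a triangle.\<close>
  have "x = a \<or> x = b" if "x \<in> A" for x
    using triangle_free[of a b x] adj[of a b] adj[of b x] adj[of a x] ab that A_sub by blast
  with ab have A: "A = {a, b}" by blast
  have "\<not> pverts X \<subseteq> {a, b}"
    using card card_mono[of "{a, b}" "pverts X"] ab(3) by auto
  then obtain c where c: "c \<in> pverts X" "c \<notin> A" unfolding A by blast
  \<comment> \<open>Stated for fresh \<open>a\<close> and \<open>b\<close>, so that it can be used
    with either of the two clique vertices as the support of \<open>c\<close>.\<close>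
  have "digraph_iso (with_proj X) (with_proj (path_graph 3))
      \<or> digraph_iso (with_proj X) (with_proj (path_graph 4))"
    if ab: "A = {a, b}" "a \<noteq> b" and ca: "f c = f a + n" for a b
  proof (cases "pverts X = {a, b, c}")
    case True
    have adjs: "(c, a) \<in> parcs X" "(c, b) \<notin> parcs X" "(a, b) \<in> parcs X"
      using True ab ca c f_eq by (auto simp: adj A_def)
    have "digraph_iso (with_proj X) (with_proj (path_graph (length [c, a, b])))"
    proof (rule digraph_iso_path_graphI)
      show "pair_graph X" by fact
      show "distinct [c, a, b]" using ab c by auto
      show "set [c, a, b] = pverts X" using True by auto
      show "\<forall>j<length [c, a, b]. \<forall>i<j. ([c, a, b] ! i, [c, a, b] ! j) \<in> parcs X \<longleftrightarrow> j = Suc i"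
        using adjs by (simp add: All_less_Suc)
    qed
    then show ?thesis by (simp add: numeral_eq_Suc)
  next
    case False
    moreover have "{a, b, c} \<subseteq> pverts X" using c A_sub ab(1) by blast
    ultimately obtain d where d: "d \<in> pverts X" "d \<notin> A" "d \<noteq> c" using ab(1) by blast
    \<comment> \<open>The one pendant place at \<open>a\<close> is taken by \<open>c\<close>, so any
      further pendant sits at \<open>b\<close>; by injectivity there is only one.\<close>
    have support_b: "f x = f b + n" if x: "x \<in> pverts X" "x \<notin> A" "x \<noteq> c" for x
      using support[OF x(1,2)] f_eq[OF x(1) c(1)] x(3) ca ab(1) by auto
    note db = support_b[OF d]
    have V_eq: "x = c \<or> x = d" if x: "x \<in> pverts X" "x \<notin> A" for x
      using support_b[OF x] f_eq[OF x(1) d(1)] db by auto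
    have V: "pverts X = {a, b, c, d}" using V_eq ab A_sub c d by auto
    have adjs: "(c, a) \<in> parcs X" "(c, b) \<notin> parcs X" "(c, d) \<notin> parcs X"
      "(a, b) \<in> parcs X" "(a, d) \<notin> parcs X" "(b, d) \<in> parcs X"
      using V ab ca db c d f_eq by (auto simp: adj A_def)
    have "digraph_iso (with_proj X) (with_proj (path_graph (length [c, a, b, d])))"
    proof (rule digraph_iso_path_graphI)
      show "pair_graph X" by fact
      show "distinct [c, a, b, d]" using ab c d by auto
      show "set [c, a, b, d] = pverts X" using V by auto
      show "\<forall>j<length [c, a, b, d]. \<forall>i<j. ([c, a, b, d] ! i, [c, a, b, d] ! j) \<in> parcs X \<longleftrightarrow> j = Suc i"
        using adjs by (simp add: All_less_Suc)
    qed
    then show ?thesis by (simp add: numeral_eq_Suc)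
  qed
  then show ?thesis using support[OF c] A ab(3) by (metis insert_commute insertE singletonD)
qed

text \<open>At least three vertices are required because the bound holds trivially for one or two: a
  connected graph always contains a vertex, and without an edge it is a single vertex with
  \<open>rvc\<close> equal to 0.\<close>

theorem theorem5:
  fixes X :: "'a pair_pre_digraph"
  assumes "pair_graph X" and "connected (with_proj X)"
    and "card (pverts X) \<ge> 3"
  shows "(\<exists>k::nat. \<forall>G :: nat pair_pre_digraph.
            pair_graph G \<and> connected (with_proj G) \<and> free_of (with_proj X) (with_proj G)
              \<longrightarrow> rvc (with_proj G) \<le> diam (with_proj G) + k)
         \<longleftrightarrow> digraph_iso (with_proj X) (with_proj (path_graph 3))
           \<or> digraph_iso (with_proj X) (with_proj (path_graph 4))"
proof
  assume "\<exists>k::nat. \<forall>G :: nat pair_pre_digraph.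
            pair_graph G \<and> connected (with_proj G) \<and> free_of (with_proj X) (with_proj G)
              \<longrightarrow> rvc (with_proj G) \<le> diam (with_proj G) + k"
  then obtain k where k: "\<And>G :: nat pair_pre_digraph. \<lbrakk>pair_graph G; connected (with_proj G);
      free_of (with_proj X) (with_proj G)\<rbrakk> \<Longrightarrow> rvc (with_proj G) \<le> diam (with_proj G) + k"
    by blast
  \<comment> \<open>The least size exceeding \<open>k + 4\<close>, the bound on \<open>rvc\<close>
    obtained from diameter 4.\<close>
  let ?n = "k + 5"
  interpret clique: dominated_corona ?n "(\<noteq>)" by unfold_locales auto
  interpret star: dominated_corona ?n "\<lambda>i j. (i = 0) \<noteq> (j = 0)" by unfold_locales auto
  obtain f where f: "induced_embedding f X (corona ?n (\<noteq>))"
    using clique.induced_embedding_of_bound[OF k assms(1)] by auto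
  obtain g where g: "induced_embedding g X (corona ?n (\<lambda>i j. (i = 0) \<noteq> (j = 0)))"
    using star.induced_embedding_of_bound[OF k assms(1)] by auto
  show "digraph_iso (with_proj X) (with_proj (path_graph 3))
      \<or> digraph_iso (with_proj X) (with_proj (path_graph 4))"
    by (rule path_of_clique_corona_embedding[OF assms f])
      (rule star_corona_triangle_free[OF _ g], simp_all)
next
  assume "digraph_iso (with_proj X) (with_proj (path_graph 3))
      \<or> digraph_iso (with_proj X) (with_proj (path_graph 4))"
  then have "rvc (with_proj G) \<le> 1"
    if "pair_graph G" "connected (with_proj G)" "free_of (with_proj X) (with_proj G)"
    for G :: "nat pair_pre_digraph"
    using rvc_le_1_of_path_free[OF assms(1) _ _ that] by auto
  then show "\<exists>k::nat. \<forall>G :: nat pair_pre_digraph.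
            pair_graph G \<and> connected (with_proj G) \<and> free_of (with_proj X) (with_proj G)
              \<longrightarrow> rvc (with_proj G) \<le> diam (with_proj G) + k"
    by (intro exI[of _ 1]) (blast intro: trans_le_add2)
qed

end
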